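(* The equi-kneading curve of $\underline{M}=RLC$ is orthogonal to the diagonal at its endpoint on the diagonal, while that of $\underline{M}=RLLRC$ is not. Precisely: (i) For $\underline{M}=RLC$ the curve $(\alpha,\Psi_{\underline{M}}(\alpha))$ meets the diagonal at $(\beta_0,\beta_0)$ with $\beta_0=\frac23$, and its slope there is $D_\alpha\Psi_{\underline{M}}(\beta_0)=-1$. (ii) For $\underline{M}=RLLRC$ the curve $(\alpha,\Psi_{\underline{M}}(\alpha))$ meets the diagonal at $(\beta_0,\beta_0)$ with $\beta_0=\frac{\sqrt5}{10}+\frac12$, and its slope there is $D_\alpha\Psi_{\underline{M}}(\beta_0)=-\frac{\sqrt5+3}{2\sqrt5+2}\ne-1$.
   Context: Let $U=\{(\alpha,\beta): 1/2<\beta\le 1,\ 1-\beta<\alpha<\beta\}$. For $(\alpha,\beta)\in U$ the skew tent map $T_{\alpha,\beta}:[0,1]\to[0,1]$ is $T_{\alpha,\beta}(x)=\frac{\beta}{\alpha}x$ for $0\le x\le\alpha$ and $T_{\alpha,\beta}(x)=\frac{\beta}{1-\alpha}(1-x)$ for $\alpha<x\le1$. The extended itinerary of $x\in[0,1]$ is the sequence indexed by $n\ge 0$ whose $n$-th entry is $L$, $C$ or $R$ according to whether $T_{\alpha,\beta}^n(x)<\alpha$, $=\alpha$ or $>\alpha$. The itinerary $\underline{I}_{\alpha,\beta}(x)$ is the extended itinerary if it contains no $C$; otherwise it is the finite string obtained by stopping at (and including) the first $C$. The kneading sequence is $K(\alpha,\beta)=\underline{I}_{\alpha,\beta}(\beta)$.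 $\mathfrak{M}$ is the set of all kneading sequences $K(1/2,\beta)$, $\beta\in(1/2,1]$; both $RLC$ and $RLLRC$ belong to $\mathfrak{M}$. Known facts (Misiurewicz–Visinescu) used to define the curves: for each $\underline{M}\in\mathfrak{M}$ there are numbers $\alpha_1(\underline{M})<\alpha_2(\underline{M})$ and a continuous function $\Psi_{\underline{M}}$ on $(\alpha_1(\underline{M}),\alpha_2(\underline{M}))$ whose graph lies in $U$ and such that for $(\alpha,\beta)\in U$ we have $K(\alpha,\beta)=\underline{M}$ if and only if $\beta=\Psi_{\underline{M}}(\alpha)$. If $\underline{M}\ne RL^\infty$, then $\lim_{\alpha\to\alpha_2(\underline{M})-}\Psi_{\underline{M}}(\alpha)=\alpha_2(\underline{M})=:\beta_0$, i.e. the curve meets the diagonal $\{(\beta,\beta):1/2<\beta<1\}$ at $(\beta_0,\beta_0)$; one extends $\Psi_{\underline{M}}$ by $\Psi_{\underline{M}}(\beta_0)=\beta_0$. $D_\alpha\Psi_{\underline{M}}(\beta_0)$ denotes the derivative of $\Psi_{\underline{M}}$ at this endpoint, $\lim_{\alpha\to\beta_0-}\frac{\Psi_{\underline{M}}(\alpha)-\beta_0}{\alpha-\beta_0}$. *)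

theory Defs
  imports "HOL-Analysis.Analysis"
begin

definition U :: "(real \<times> real) set" where
  "U = {(\<alpha>, \<beta>). 1/2 < \<beta> \<and> \<beta> \<le> 1 \<and> 1 - \<beta> < \<alpha> \<and> \<alpha> < \<beta>}"

(* Total on real; for (\<alpha>, \<beta>) \<in> U it maps {0..1} into itself and only its values there matter. *)
definition skew_tent :: "real \<Rightarrow> real \<Rightarrow> real \<Rightarrow> real" where
  "skew_tent \<alpha> \<beta> x = (if x \<le> \<alpha> then \<beta> / \<alpha> * x else \<beta> / (1 - \<alpha>) * (1 - x))"

datatype symbol = L | C | R

definition ext_itinerary :: "real \<Rightarrow> real \<Rightarrow> real \<Rightarrow> nat \<Rightarrow> symbol" where
  "ext_itinerary \<alpha> \<beta> x n =
     (let y = (skew_tent \<alpha> \<beta> ^^ n) x in if y < \<alpha> then L else if y = \<alpha> then C else R)"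

datatype itin = Finite_itin "symbol list" | Infinite_itin "nat \<Rightarrow> symbol"

definition itinerary :: "real \<Rightarrow> real \<Rightarrow> real \<Rightarrow> itin" where
  "itinerary \<alpha> \<beta> x =
     (if \<exists>n. ext_itinerary \<alpha> \<beta> x n = C
      then Finite_itin (map (ext_itinerary \<alpha> \<beta> x) [0..<Suc (LEAST n. ext_itinerary \<alpha> \<beta> x n = C)])
      else Infinite_itin (ext_itinerary \<alpha> \<beta> x))"

definition kneading :: "real \<Rightarrow> real \<Rightarrow> itin" where
  "kneading \<alpha> \<beta> = itinerary \<alpha> \<beta> \<beta>"

definition kneading_sequences :: "itin set" where
  "kneading_sequences = {kneading (1/2) \<beta> |\<beta>. 1/2 < \<beta> \<and> \<beta> \<le> 1}"

(* The Misiurewicz-Visinescu properties determine \<alpha>1, \<alpha>2 and the values of \<Psi> on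
   {\<alpha>1<..<\<alpha>2} uniquely; \<Psi> is arbitrary outside that interval. *)
definition equi_kneading_curve :: "itin \<Rightarrow> real \<Rightarrow> real \<Rightarrow> (real \<Rightarrow> real) \<Rightarrow> bool" where
  "equi_kneading_curve M \<alpha>1 \<alpha>2 \<Psi> \<longleftrightarrow>
     M \<in> kneading_sequences \<and> \<alpha>1 < \<alpha>2 \<and>
     continuous_on {\<alpha>1<..<\<alpha>2} \<Psi> \<and>
     (\<forall>\<alpha>\<in>{\<alpha>1<..<\<alpha>2}. (\<alpha>, \<Psi> \<alpha>) \<in> U) \<and>
     (\<forall>(\<alpha>, \<beta>)\<in>U. kneading \<alpha> \<beta> = M \<longleftrightarrow> \<alpha> \<in> {\<alpha>1<..<\<alpha>2} \<and> \<beta> = \<Psi> \<alpha>)"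

definition diagonal :: "(real \<times> real) set" where
  "diagonal = {(\<beta>, \<beta>) |\<beta>. 1/2 < \<beta> \<and> \<beta> < 1}"

definition meets_diagonal_at :: "(real \<Rightarrow> real) \<Rightarrow> real \<Rightarrow> real \<Rightarrow> bool" where
  "meets_diagonal_at \<Psi> \<alpha>2 \<beta>0 \<longleftrightarrow>
     (\<beta>0, \<beta>0) \<in> diagonal \<and> \<alpha>2 = \<beta>0 \<and> (\<Psi> \<longlongrightarrow> \<beta>0) (at_left \<alpha>2)"

(* Left derivative at \<beta>0 of \<Psi> extended by the value \<beta>0 at \<beta>0. *)
definition has_endpoint_slope :: "(real \<Rightarrow> real) \<Rightarrow> real \<Rightarrow> real \<Rightarrow> bool" where
  "has_endpoint_slope \<Psi> \<beta>0 D \<longleftrightarrow>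
     ((\<lambda>\<alpha>. (\<Psi> \<alpha> - \<beta>0) / (\<alpha> - \<beta>0)) \<longlongrightarrow> D) (at_left \<beta>0)"

definition orthogonal_to_diagonal_at :: "(real \<Rightarrow> real) \<Rightarrow> real \<Rightarrow> bool" where
  "orthogonal_to_diagonal_at \<Psi> \<beta>0 \<longleftrightarrow>
     (\<exists>D. has_endpoint_slope \<Psi> \<beta>0 D \<and> orthogonal (1 :: real, D) (1, 1))"

end

theory Submission
  imports Defs
begin

text \<open>
  For both words the kneading condition reduces to one polynomial equation. Following the orbit of
  \<open>\<beta>\<close> along the branches prescribed by the word, the final letter \<open>C\<close> says that some explicit
  rational function of \<open>\<alpha>\<close> and \<open>\<beta>\<close> equals \<open>\<alpha>\<close>. All inequalities
  required by the earlier letters then follow from this equation and \<open>(\<alpha>, \<beta>) \<in> U\<close>. After clearing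
  denominators the equation is divisible by \<open>\<beta> - \<alpha>\<close>, because on the diagonal the turning point
  is fixed by the map. Dividing by it leaves a polynomial \<open>G\<close> whose zeros in \<open>U\<close> are exactly the
  parameters with the given word (\<open>kneading_RLC_iff\<close>, \<open>kneading_RLLRC_iff\<close>) and which does not
  vanish identically on the diagonal. The endpoint \<open>(b, b)\<close> is the zero of \<open>G\<close> on the diagonal with
  \<open>1/2 < b < 1\<close>.

  For fixed \<open>\<alpha> < b\<close> the polynomial is positive at the lower end \<open>max \<alpha> (1 - \<alpha>)\<close> of the
  admissible \<open>\<beta>\<close> and negative at \<open>\<beta> = 1\<close>, so it has a root. Its uniqueness, and the absence of
  roots for \<open>\<alpha> \<ge> b\<close>, holds for \<open>RLC\<close> because \<open>G \<alpha>\<close> is then a quadratic that decreases strictly for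
  \<open>\<beta> \<ge> (1 - \<alpha>) / 2\<close>, and because \<open>G \<alpha> \<alpha> \<le> 0\<close> when \<open>\<alpha> \<ge> b\<close>. For \<open>RLLRC\<close> the equation is rewritten
  as a level set of \<open>\<beta>\<^sup>4 (1 - \<beta>) / (\<beta> - \<alpha> (1 - \<alpha>))\<close>. This ratio first increases and then decreases
  in \<open>\<beta> \<ge> 1/2\<close>, and it is at or above the level at the lower end, so the level is attained at most
  once beyond it. For \<open>\<alpha> \<ge> b\<close> the lower end is \<open>\<alpha>\<close>, where the ratio equals the level and is already
  past its increasing phase, so the level is not attained again
  (\<open>level_ratio_unimodal\<close>, \<open>level_ratio_lower_end\<close>). The locale
  \<open>kneading_equation\<close> turns these sign facts into the existence and continuity of the curve, and
  shows that any equi-kneading curve of the word lives over \<open>(0, b)\<close> and tends to \<open>b\<close>.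

  The slope is implicit differentiation at the endpoint. Writing
  \<open>G \<alpha> \<beta> = A \<alpha> \<beta> * (\<beta> - b) + B \<alpha> \<beta> * (\<alpha> - b)\<close> with polynomials \<open>A\<close> and \<open>B\<close>, the difference quotient
  along the curve is exactly \<open>- B / A\<close>, which converges to \<open>- B b b / A b b\<close>.
\<close>

section \<open>Finite itineraries\<close>

lemma ext_itinerary_Suc:
  "ext_itinerary \<alpha> \<beta> x (Suc n) = ext_itinerary \<alpha> \<beta> (skew_tent \<alpha> \<beta> x) n"
  by (simp add: ext_itinerary_def funpow_swap1)

lemma ext_itinerary_0:
  "ext_itinerary \<alpha> \<beta> x 0 = (if x < \<alpha> then L else if x = \<alpha> then C else R)"
  by (simp add: ext_itinerary_def)

lemma itinerary_turning_point: "itinerary \<alpha> \<beta> \<alpha> = Finite_itin [C]"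
proof -
  have "(LEAST n. ext_itinerary \<alpha> \<beta> \<alpha> n = C) = 0"
    by (rule Least_eq_0) (simp add: ext_itinerary_0)
  moreover have "\<exists>n. ext_itinerary \<alpha> \<beta> \<alpha> n = C"
    by (rule exI[of _ 0]) (simp add: ext_itinerary_0)
  ultimately show ?thesis
    by (simp add: itinerary_def ext_itinerary_0)
qed

lemma itinerary_off_turning_point:
  assumes "x \<noteq> \<alpha>"
  shows "itinerary \<alpha> \<beta> x = Finite_itin w \<longleftrightarrow>
    (\<exists>v. w = ext_itinerary \<alpha> \<beta> x 0 # v \<and> itinerary \<alpha> \<beta> (skew_tent \<alpha> \<beta> x) = Finite_itin v)"
proof (cases "\<exists>n. ext_itinerary \<alpha> \<beta> (skew_tent \<alpha> \<beta> x) n = C")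
  case True
  then obtain n where "ext_itinerary \<alpha> \<beta> x (Suc n) = C"
    by (auto simp: ext_itinerary_Suc)
  then have "(LEAST n. ext_itinerary \<alpha> \<beta> x n = C)
      = Suc (LEAST n. ext_itinerary \<alpha> \<beta> (skew_tent \<alpha> \<beta> x) n = C)"
    unfolding ext_itinerary_Suc[symmetric]
    by (rule Least_Suc) (use assms in \<open>simp add: ext_itinerary_0\<close>)
  moreover have "\<exists>n. ext_itinerary \<alpha> \<beta> x n = C"
    using \<open>ext_itinerary \<alpha> \<beta> x (Suc n) = C\<close> by blast
  ultimately show ?thesis
    using True by (auto simp: itinerary_def map_upt_Suc ext_itinerary_Suc simp del: upt_Suc)
next
  case False
  then have "ext_itinerary \<alpha> \<beta> x n \<noteq> C" for n
    using assms by (cases n) (auto simp: ext_itinerary_Suc ext_itinerary_0)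
  then show ?thesis
    using False by (simp add: itinerary_def)
qed

lemma itinerary_eq_C_iff: "itinerary \<alpha> \<beta> x = Finite_itin [C] \<longleftrightarrow> x = \<alpha>"
  using itinerary_off_turning_point[of x \<alpha> \<beta> "[C]"]
  by (cases "x = \<alpha>") (auto simp: itinerary_turning_point ext_itinerary_0)

lemma itinerary_eq_L_iff:
  "itinerary \<alpha> \<beta> x = Finite_itin (L # w) \<longleftrightarrow>
    x < \<alpha> \<and> itinerary \<alpha> \<beta> (\<beta> / \<alpha> * x) = Finite_itin w"
  using itinerary_off_turning_point[of x \<alpha> \<beta> "L # w"]
  by (cases "x = \<alpha>") (auto simp: itinerary_turning_point ext_itinerary_0 skew_tent_def)

lemma itinerary_eq_R_iff:
  "itinerary \<alpha> \<beta> x = Finite_itin (R # w) \<longleftrightarrow>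
    \<alpha> < x \<and> itinerary \<alpha> \<beta> (\<beta> / (1 - \<alpha>) * (1 - x)) = Finite_itin w"
  using itinerary_off_turning_point[of x \<alpha> \<beta> "R # w"]
  by (cases "x = \<alpha>") (auto simp: itinerary_turning_point ext_itinerary_0 skew_tent_def)

section \<open>Curves cut out by an equation\<close>

lemma U_iff: "(\<alpha>, \<beta>) \<in> U \<longleftrightarrow> max \<alpha> (1 - \<alpha>) < \<beta> \<and> \<beta> \<le> 1"
  by (auto simp: U_def)

lemma U_bounds:
  assumes "(\<alpha>, \<beta>) \<in> U"
  shows "0 < \<alpha>" "\<alpha> < 1" "\<alpha> < \<beta>" "1 - \<alpha> < \<beta>" "1/2 < \<beta>" "\<beta> \<le> 1"
  using assms by (auto simp: U_def)

text \<open>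
  The sign conditions describe \<open>G \<alpha>\<close> on the boundary of the vertical slice of \<open>U\<close> over \<open>\<alpha>\<close>; they
  force a root in each slice with \<open>\<alpha> < b\<close>.
\<close>
locale kneading_equation =
  fixes M :: itin and G :: "real \<Rightarrow> real \<Rightarrow> real" and b :: real
  assumes kneading_iff: "(\<alpha>, \<beta>) \<in> U \<Longrightarrow> kneading \<alpha> \<beta> = M \<longleftrightarrow> G \<alpha> \<beta> = 0"
    and b_gt: "1/2 < b" and b_less: "b < 1"
    and pos_antidiagonal: "0 < \<alpha> \<Longrightarrow> \<alpha> < 1 \<Longrightarrow> 0 < G \<alpha> (1 - \<alpha>)"
    and pos_diagonal: "1/2 \<le> \<alpha> \<Longrightarrow> \<alpha> < b \<Longrightarrow> 0 < G \<alpha> \<alpha>"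
    and neg_top: "0 < \<alpha> \<Longrightarrow> \<alpha> < 1 \<Longrightarrow> G \<alpha> 1 < 0"
    and root_unique: "(\<alpha>, \<beta>) \<in> U \<Longrightarrow> (\<alpha>, \<gamma>) \<in> U \<Longrightarrow> G \<alpha> \<beta> = 0 \<Longrightarrow> G \<alpha> \<gamma> = 0 \<Longrightarrow> \<beta> = \<gamma>"
    and no_root: "(\<alpha>, \<beta>) \<in> U \<Longrightarrow> b \<le> \<alpha> \<Longrightarrow> G \<alpha> \<beta> \<noteq> 0"
    and cont_fst: "continuous_on UNIV (\<lambda>\<alpha>. G \<alpha> \<beta>)"
    and cont_snd: "continuous_on UNIV (G \<alpha>)"
begin

lemma root_between:
  assumes "x \<le> y" and "G \<alpha> y \<le> 0" and "0 \<le> G \<alpha> x"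
  obtains z where "x \<le> z" and "z \<le> y" and "G \<alpha> z = 0"
  using IVT2'[of "G \<alpha>" y 0 x] assms continuous_on_subset[OF cont_snd] by blast

lemma ex_root:
  assumes "0 < \<alpha>" and "\<alpha> < b"
  shows "\<exists>\<beta>. (\<alpha>, \<beta>) \<in> U \<and> G \<alpha> \<beta> = 0"
proof -
  have pos: "0 < G \<alpha> (max \<alpha> (1 - \<alpha>))"
    using pos_diagonal pos_antidiagonal assms b_less by (simp add: max_def)
  obtain z where z: "max \<alpha> (1 - \<alpha>) \<le> z" "z \<le> 1" "G \<alpha> z = 0"
    using root_between[of "max \<alpha> (1 - \<alpha>)" 1 \<alpha>] pos neg_top[of \<alpha>] assms b_less by auto
  with pos have "max \<alpha> (1 - \<alpha>) \<noteq> z"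
    by auto
  with z have "(\<alpha>, z) \<in> U"
    by (auto simp: U_iff simp del: max_less_iff_conj)
  with z show ?thesis
    by blast
qed

lemma pos_below_root:
  assumes "(\<alpha>, \<beta>) \<in> U" and "(\<alpha>, \<gamma>) \<in> U" and "G \<alpha> \<gamma> = 0" and "\<beta> < \<gamma>"
  shows "0 < G \<alpha> \<beta>"
proof (rule ccontr)
  assume "\<not> 0 < G \<alpha> \<beta>"
  have "\<alpha> < b"
    using no_root assms by force
  then have pos: "0 < G \<alpha> (max \<alpha> (1 - \<alpha>))"
    using pos_diagonal pos_antidiagonal U_bounds[OF assms(1)] by (simp add: max_def)
  obtain z where z: "max \<alpha> (1 - \<alpha>) \<le> z" "z \<le> \<beta>" "G \<alpha> z = 0"
    using root_between[of "max \<alpha> (1 - \<alpha>)" \<beta> \<alpha>] pos \<open>\<not> 0 < G \<alpha> \<beta>\<close> U_bounds[OF assms(1)] by auto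
  with pos have "max \<alpha> (1 - \<alpha>) \<noteq> z"
    by auto
  with z U_bounds[OF assms(1)] have "(\<alpha>, z) \<in> U"
    by (auto simp: U_iff simp del: max_less_iff_conj)
  with z assms root_unique show False
    by fastforce
qed

lemma neg_if_no_root_above:
  assumes "(\<alpha>, \<beta>) \<in> U" and "\<And>\<gamma>. \<beta> \<le> \<gamma> \<Longrightarrow> (\<alpha>, \<gamma>) \<in> U \<Longrightarrow> G \<alpha> \<gamma> \<noteq> 0"
  shows "G \<alpha> \<beta> < 0"
proof (rule ccontr)
  assume "\<not> G \<alpha> \<beta> < 0"
  then obtain z where "\<beta> \<le> z" "z \<le> 1" "G \<alpha> z = 0"
    using root_between[of \<beta> 1 \<alpha>] neg_top[of \<alpha>] U_bounds[OF assms(1)] by auto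
  with assms show False
    by (auto simp: U_iff)
qed

lemma neg_above_root:
  assumes "(\<alpha>, \<beta>) \<in> U" and "(\<alpha>, \<gamma>) \<in> U" and "G \<alpha> \<gamma> = 0" and "\<gamma> < \<beta>"
  shows "G \<alpha> \<beta> < 0"
  using neg_if_no_root_above[OF assms(1)] root_unique[OF _ assms(2) _ assms(3)] assms(4)
  by fastforce

lemma eventually_pos:
  assumes "0 < G a y"
  shows "\<forall>\<^sub>F \<alpha> in at a within S. 0 < G \<alpha> y"
proof -
  have "((\<lambda>\<alpha>. G \<alpha> y) \<longlongrightarrow> G a y) (at a within S)"
    using cont_fst by (meson UNIV_I continuous_on_def subset_UNIV tendsto_within_subset)
  then show ?thesis
    using assms by (rule order_tendstoD)
qed

lemma eventually_neg:
  assumes "G a y < 0"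
  shows "\<forall>\<^sub>F \<alpha> in at a within S. G \<alpha> y < 0"
proof -
  have "((\<lambda>\<alpha>. G \<alpha> y) \<longlongrightarrow> G a y) (at a within S)"
    using cont_fst by (meson UNIV_I continuous_on_def subset_UNIV tendsto_within_subset)
  then show ?thesis
    using assms by (rule order_tendstoD)
qed

lemma eventually_in_U:
  assumes "max a (1 - a) < y" and "y \<le> 1"
  shows "\<forall>\<^sub>F \<alpha> in at a within S. (\<alpha>, y) \<in> U"
proof -
  have "((\<lambda>\<alpha>. max \<alpha> (1 - \<alpha>)) \<longlongrightarrow> max a (1 - a)) (at a within S)"
    by (intro tendsto_intros)
  then have "\<forall>\<^sub>F \<alpha> in at a within S. max \<alpha> (1 - \<alpha>) < y"
    using assms(1) by (rule order_tendstoD)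
  then show ?thesis
    using assms(2) by (simp add: U_iff)
qed

text \<open>
  The sign of \<open>G \<alpha> y\<close> tells on which side of \<open>y\<close> the root lies, and this sign is locally constant in
  \<open>\<alpha>\<close>. So the root cannot jump across \<open>y\<close>.
\<close>
lemma root_continuous:
  assumes root: "\<And>\<alpha>. \<alpha> \<in> {0<..<b} \<Longrightarrow> (\<alpha>, \<psi> \<alpha>) \<in> U \<and> G \<alpha> (\<psi> \<alpha>) = 0"
  shows "continuous_on {0<..<b} \<psi>"
  unfolding continuous_on_def
proof
  fix a assume a: "a \<in> {0<..<b}"
  note aU = conjunct1[OF root[OF a]] and aG = conjunct2[OF root[OF a]]
  have near: "\<forall>\<^sub>F \<alpha> in at a within {0<..<b}. \<alpha> \<in> {0<..<b}"
    by (simp add: eventually_at_filter)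
  show "(\<psi> \<longlongrightarrow> \<psi> a) (at a within {0<..<b})"
  proof (rule order_tendstoI)
    fix y assume "y < \<psi> a"
    then obtain z where z: "max y (max a (1 - a)) < z" "z < \<psi> a"
      using dense[of "max y (max a (1 - a))" "\<psi> a"] aU by (auto simp: U_iff)
    then have "(a, z) \<in> U"
      using U_bounds[OF aU] by (auto simp: U_iff)
    from pos_below_root[OF this aU aG z(2)]
    have "0 < G a z" .
    moreover have "max a (1 - a) < z" "z \<le> 1"
      using z U_bounds[OF aU] by auto
    ultimately have "\<forall>\<^sub>F \<alpha> in at a within {0<..<b}. 0 < G \<alpha> z \<and> (\<alpha>, z) \<in> U \<and> \<alpha> \<in> {0<..<b}"
      by (intro eventually_conj eventually_pos eventually_in_U near)
    then show "\<forall>\<^sub>F \<alpha> in at a within {0<..<b}. y < \<psi> \<alpha>"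
    proof eventually_elim
      case (elim \<alpha>)
      then have "\<not> \<psi> \<alpha> \<le> z"
        using neg_above_root[of \<alpha> z "\<psi> \<alpha>"] root[of \<alpha>] by force
      with z show ?case by auto
    qed
  next
    fix y assume "\<psi> a < y"
    show "\<forall>\<^sub>F \<alpha> in at a within {0<..<b}. \<psi> \<alpha> < y"
    proof (cases "y \<le> 1")
      case True
      then have "(a, y) \<in> U"
        using aU \<open>\<psi> a < y\<close> by (auto simp: U_iff)
      from neg_above_root[OF this aU aG \<open>\<psi> a < y\<close>]
      have "\<forall>\<^sub>F \<alpha> in at a within {0<..<b}. G \<alpha> y < 0 \<and> (\<alpha>, y) \<in> U \<and> \<alpha> \<in> {0<..<b}"
        using \<open>(a, y) \<in> U\<close>
        by (intro eventually_conj eventually_neg eventually_in_U near) (auto simp: U_iff)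
      then show ?thesis
      proof eventually_elim
        case (elim \<alpha>)
        then have "\<not> y < \<psi> \<alpha>" "y \<noteq> \<psi> \<alpha>"
          using pos_below_root[of \<alpha> y "\<psi> \<alpha>"] root[of \<alpha>] by force+
        then show ?case
          by simp
      qed
    next
      case False
      from near show ?thesis
        by eventually_elim (use False root in \<open>force simp: U_iff\<close>)
    qed
  qed
qed

lemma ex_curve: "\<exists>\<alpha>1 \<alpha>2 \<Psi>. equi_kneading_curve M \<alpha>1 \<alpha>2 \<Psi>"
proof -
  have "\<forall>\<alpha>. \<exists>\<beta>. \<alpha> \<in> {0<..<b} \<longrightarrow> (\<alpha>, \<beta>) \<in> U \<and> G \<alpha> \<beta> = 0"
    using ex_root by auto
  then obtain \<psi> where root: "\<And>\<alpha>. \<alpha> \<in> {0<..<b} \<Longrightarrow> (\<alpha>, \<psi> \<alpha>) \<in> U \<and> G \<alpha> (\<psi> \<alpha>) = 0"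
    by metis
  have "(1/2, \<psi> (1/2)) \<in> U" "kneading (1/2) (\<psi> (1/2)) = M"
    using root[of "1/2"] b_gt kneading_iff by auto
  then have "M \<in> kneading_sequences"
    unfolding kneading_sequences_def U_def by force
  moreover have "kneading \<alpha> \<beta> = M \<longleftrightarrow> \<alpha> \<in> {0<..<b} \<and> \<beta> = \<psi> \<alpha>" if "(\<alpha>, \<beta>) \<in> U" for \<alpha> \<beta>
  proof -
    have "\<alpha> \<in> {0<..<b} \<and> \<beta> = \<psi> \<alpha>" if "G \<alpha> \<beta> = 0"
    proof -
      have "\<alpha> \<in> {0<..<b}"
        using no_root[OF \<open>(\<alpha>, \<beta>) \<in> U\<close>] that U_bounds[OF \<open>(\<alpha>, \<beta>) \<in> U\<close>] by force
      with root[of \<alpha>] root_unique[of \<alpha> \<beta> "\<psi> \<alpha>"] that \<open>(\<alpha>, \<beta>) \<in> U\<close> show ?thesis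
        by blast
    qed
    with root that show ?thesis
      by (auto simp: kneading_iff)
  qed
  ultimately have "equi_kneading_curve M 0 b \<psi>"
    using root_continuous[OF root] root b_gt by (auto simp: equi_kneading_curve_def)
  then show ?thesis
    by blast
qed

context
  fixes \<alpha>1 \<alpha>2 \<Psi>
  assumes curve: "equi_kneading_curve M \<alpha>1 \<alpha>2 \<Psi>"
begin

lemma curve_domain: "\<alpha>1 = 0" "\<alpha>2 = b"
proof -
  have "\<alpha> \<in> {\<alpha>1<..<\<alpha>2} \<longleftrightarrow> (\<exists>\<beta>. (\<alpha>, \<beta>) \<in> U \<and> G \<alpha> \<beta> = 0)" for \<alpha>
    using curve kneading_iff by (fastforce simp: equi_kneading_curve_def)
  moreover have "\<alpha> \<in> {0<..<b} \<longleftrightarrow> (\<exists>\<beta>. (\<alpha>, \<beta>) \<in> U \<and> G \<alpha> \<beta> = 0)" for \<alpha>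
    using ex_root no_root U_bounds(1) by (metis greaterThanLessThan_iff linorder_not_le)
  ultimately have "{\<alpha>1<..<\<alpha>2} = {0<..<b}"
    by blast
  moreover have "\<alpha>1 < \<alpha>2"
    using curve by (simp add: equi_kneading_curve_def)
  ultimately show "\<alpha>1 = 0" "\<alpha>2 = b"
    using b_gt by (metis greaterThanLessThan_empty_iff2 greaterThanLessThan_eq_iff not_le)+
qed

lemma curve_root:
  assumes "\<alpha> \<in> {0<..<b}"
  shows "(\<alpha>, \<Psi> \<alpha>) \<in> U" and "G \<alpha> (\<Psi> \<alpha>) = 0"
proof -
  show "(\<alpha>, \<Psi> \<alpha>) \<in> U"
    using curve assms curve_domain by (simp add: equi_kneading_curve_def)
  then show "G \<alpha> (\<Psi> \<alpha>) = 0"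
    using curve assms curve_domain kneading_iff by (fastforce simp: equi_kneading_curve_def)
qed

lemma eventually_in_domain: "\<forall>\<^sub>F \<alpha> in at_left b. \<alpha> \<in> {0<..<b}"
  using b_gt by (intro eventually_at_left_real) auto

text \<open>
  The curve stays above the diagonal, which gives the lower bound of the limit. A point \<open>(b, y)\<close>
  above the endpoint has \<open>G b y < 0\<close> since there is no root over \<open>b\<close>, so nearby roots lie below \<open>y\<close>.
\<close>
lemma curve_tendsto: "(\<Psi> \<longlongrightarrow> b) (at_left b)"
proof (rule order_tendstoI)
  fix y assume "y < b"
  then have "\<forall>\<^sub>F \<alpha> in at_left b. \<alpha> \<in> {y<..<b}"
    by (rule eventually_at_left_real)
  with eventually_in_domain show "\<forall>\<^sub>F \<alpha> in at_left b. y < \<Psi> \<alpha>"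
    by eventually_elim (use curve_root U_bounds(3) in force)
next
  fix y assume "b < y"
  then have "b < min y 1"
    using b_less by simp
  then have U: "(b, min y 1) \<in> U"
    using b_gt by (auto simp: U_iff)
  have "G b (min y 1) < 0"
    by (rule neg_if_no_root_above[OF U]) (simp add: no_root)
  then have "\<forall>\<^sub>F \<alpha> in at_left b. G \<alpha> (min y 1) < 0 \<and> (\<alpha>, min y 1) \<in> U \<and> \<alpha> \<in> {0<..<b}"
    using U b_gt
    by (intro eventually_conj eventually_neg eventually_in_U eventually_in_domain)
       (auto simp: U_iff)
  then show "\<forall>\<^sub>F \<alpha> in at_left b. \<Psi> \<alpha> < y"
  proof eventually_elim
    case (elim \<alpha>)
    then have "\<not> min y 1 \<le> \<Psi> \<alpha>"
      using pos_below_root[of \<alpha> "min y 1" "\<Psi> \<alpha>"] curve_root[of \<alpha>] by force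
    then show ?case
      by simp
  qed
qed

lemma curve_meets_diagonal: "meets_diagonal_at \<Psi> \<alpha>2 b"
  using curve_domain curve_tendsto b_gt b_less by (auto simp: meets_diagonal_at_def diagonal_def)

text \<open>
  Implicit differentiation at the endpoint: along the curve \<open>G\<close> vanishes, so the decomposition solves
  exactly for the difference quotient, and the coefficients pass to the limit.
\<close>
lemma curve_slope:
  assumes decomp: "\<And>\<alpha> \<beta>. G \<alpha> \<beta> = A \<alpha> \<beta> * (\<beta> - b) + B \<alpha> \<beta> * (\<alpha> - b)"
    and A: "((\<lambda>\<alpha>. A \<alpha> (\<Psi> \<alpha>)) \<longlongrightarrow> A b b) (at_left b)"
    and B: "((\<lambda>\<alpha>. B \<alpha> (\<Psi> \<alpha>)) \<longlongrightarrow> B b b) (at_left b)"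
    and nz: "A b b \<noteq> 0"
  shows "has_endpoint_slope \<Psi> b (- (B b b / A b b))"
  unfolding has_endpoint_slope_def
proof (rule Lim_transform_eventually)
  show "((\<lambda>\<alpha>. - (B \<alpha> (\<Psi> \<alpha>) / A \<alpha> (\<Psi> \<alpha>))) \<longlongrightarrow> - (B b b / A b b)) (at_left b)"
    by (intro tendsto_intros A B nz)
  have "\<forall>\<^sub>F \<alpha> in at_left b. A \<alpha> (\<Psi> \<alpha>) \<noteq> 0"
    using tendsto_imp_eventually_ne[OF A nz] .
  with eventually_in_domain
  show "\<forall>\<^sub>F \<alpha> in at_left b. - (B \<alpha> (\<Psi> \<alpha>) / A \<alpha> (\<Psi> \<alpha>)) = (\<Psi> \<alpha> - b) / (\<alpha> - b)"
  proof eventually_elim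
    case (elim \<alpha>)
    then have "A \<alpha> (\<Psi> \<alpha>) * (\<Psi> \<alpha> - b) + B \<alpha> (\<Psi> \<alpha>) * (\<alpha> - b) = 0"
      using curve_root(2)[of \<alpha>] decomp by simp
    with elim show ?case
      by (simp add: divide_simps) (simp add: algebra_simps)
  qed
qed

end

end

lemma orthogonal_to_diagonal_iff:
  assumes "has_endpoint_slope \<Psi> b D"
  shows "orthogonal_to_diagonal_at \<Psi> b \<longleftrightarrow> D = -1"
proof -
  have "E = D" if "has_endpoint_slope \<Psi> b E" for E
    using that assms tendsto_unique[OF trivial_limit_at_left_real]
    unfolding has_endpoint_slope_def by blast
  then have "orthogonal_to_diagonal_at \<Psi> b \<longleftrightarrow> orthogonal (1 :: real, D) (1, 1)"
    using assms unfolding orthogonal_to_diagonal_at_def by blast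
  then show ?thesis
    by (auto simp: orthogonal_def inner_prod_def)
qed

section \<open>The word RLC\<close>

definition RLC_poly :: "real \<Rightarrow> real \<Rightarrow> real" where
  "RLC_poly \<alpha> \<beta> = \<alpha> + \<beta> - (\<alpha>\<^sup>2 + \<alpha> * \<beta> + \<beta>\<^sup>2)"

lemma kneading_RLC_iff:
  assumes U: "(\<alpha>, \<beta>) \<in> U"
  shows "kneading \<alpha> \<beta> = Finite_itin [R, L, C] \<longleftrightarrow> RLC_poly \<alpha> \<beta> = 0"
proof -
  note b = U_bounds[OF U]
  define x where "x = \<beta> / (1 - \<alpha>) * (1 - \<beta>)"
  have "kneading \<alpha> \<beta> = Finite_itin [R, L, C] \<longleftrightarrow> x < \<alpha> \<and> \<beta> / \<alpha> * x = \<alpha>"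
    using b by (simp add: kneading_def itinerary_eq_R_iff itinerary_eq_L_iff itinerary_eq_C_iff x_def)
  also have "\<dots> \<longleftrightarrow> \<beta> / \<alpha> * x = \<alpha>"
  proof -
    have "x < \<alpha>" if "\<beta> / \<alpha> * x = \<alpha>"
    proof -
      have "x = \<alpha> * (\<alpha> / \<beta>)"
        using that b by (simp add: field_simps)
      also have "\<dots> < \<alpha> * 1"
        using b by (intro mult_strict_left_mono) auto
      finally show ?thesis by simp
    qed
    then show ?thesis by blast
  qed
  also have "\<dots> \<longleftrightarrow> \<beta>\<^sup>2 * (1 - \<beta>) = \<alpha>\<^sup>2 * (1 - \<alpha>)"
    using b by (simp add: x_def field_simps power2_eq_square)
  also have "\<dots> \<longleftrightarrow> (\<beta> - \<alpha>) * RLC_poly \<alpha> \<beta> = 0"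
    by (simp add: RLC_poly_def algebra_simps power2_eq_square)
  also have "\<dots> \<longleftrightarrow> RLC_poly \<alpha> \<beta> = 0"
    using b by simp
  finally show ?thesis .
qed

interpretation RLC: kneading_equation "Finite_itin [R, L, C]" RLC_poly "2/3"
proof
  fix \<alpha> \<beta> \<gamma> :: real
  show "(\<alpha>, \<beta>) \<in> U \<Longrightarrow> kneading \<alpha> \<beta> = Finite_itin [R, L, C] \<longleftrightarrow> RLC_poly \<alpha> \<beta> = 0"
    by (rule kneading_RLC_iff)
  have "RLC_poly \<alpha> (1 - \<alpha>) = \<alpha> * (1 - \<alpha>)"
    by (simp add: RLC_poly_def algebra_simps power2_eq_square)
  then show "0 < \<alpha> \<Longrightarrow> \<alpha> < 1 \<Longrightarrow> 0 < RLC_poly \<alpha> (1 - \<alpha>)"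
    by simp
  have diagonal: "RLC_poly \<alpha> \<alpha> = \<alpha> * (2 - 3 * \<alpha>)"
    by (simp add: RLC_poly_def algebra_simps power2_eq_square)
  then show "1/2 \<le> \<alpha> \<Longrightarrow> \<alpha> < 2/3 \<Longrightarrow> 0 < RLC_poly \<alpha> \<alpha>"
    by simp
  show "0 < \<alpha> \<Longrightarrow> \<alpha> < 1 \<Longrightarrow> RLC_poly \<alpha> 1 < 0"
    by (simp add: RLC_poly_def)
  have diff: "RLC_poly \<alpha> \<beta> - RLC_poly \<alpha> \<gamma> = (\<beta> - \<gamma>) * (1 - \<alpha> - \<beta> - \<gamma>)" for \<alpha> \<beta> \<gamma>
    by (simp add: RLC_poly_def algebra_simps power2_eq_square)
  {
    assume "(\<alpha>, \<beta>) \<in> U" "(\<alpha>, \<gamma>) \<in> U" "RLC_poly \<alpha> \<beta> = 0" "RLC_poly \<alpha> \<gamma> = 0"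
    with diff[of \<alpha> \<beta> \<gamma>] U_bounds[of \<alpha> \<beta>] U_bounds[of \<alpha> \<gamma>] show "\<beta> = \<gamma>"
      by auto
  next
    assume U: "(\<alpha>, \<beta>) \<in> U" and "2/3 \<le> \<alpha>"
    then have "RLC_poly \<alpha> \<alpha> \<le> 0"
      by (simp add: diagonal mult_nonneg_nonpos)
    moreover have "(\<beta> - \<alpha>) * (1 - \<alpha> - \<beta> - \<alpha>) < 0"
      using U_bounds[OF U] by (intro mult_pos_neg) auto
    ultimately show "RLC_poly \<alpha> \<beta> \<noteq> 0"
      using diff[of \<alpha> \<beta> \<alpha>] by simp
  }
  show "continuous_on UNIV (\<lambda>\<alpha>. RLC_poly \<alpha> \<beta>)" "continuous_on UNIV (RLC_poly \<alpha>)"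
    unfolding RLC_poly_def by (intro continuous_intros)+
qed auto

lemma RLC_slope:
  assumes curve: "equi_kneading_curve (Finite_itin [R, L, C]) \<alpha>1 \<alpha>2 \<Psi>"
  shows "has_endpoint_slope \<Psi> (2/3) (-1)"
proof -
  \<comment> \<open>Divided differences of \<open>RLC_poly\<close>, first in \<open>\<beta>\<close> between \<open>\<beta>\<close> and \<open>2/3\<close>, then in \<open>\<alpha>\<close> at \<open>\<beta> = 2/3\<close>.\<close>
  define A B :: "real \<Rightarrow> real \<Rightarrow> real"
    where "A = (\<lambda>\<alpha> \<beta>. 1/3 - \<beta> - \<alpha>)" and "B = (\<lambda>\<alpha> \<beta>. - 1/3 - \<alpha>)"
  note lim = RLC.curve_tendsto[OF curve]
  have "has_endpoint_slope \<Psi> (2/3) (- (B (2/3) (2/3) / A (2/3) (2/3)))"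
  proof (rule RLC.curve_slope[OF curve, where A = A and B = B])
    show "RLC_poly \<alpha> \<beta> = A \<alpha> \<beta> * (\<beta> - 2/3) + B \<alpha> \<beta> * (\<alpha> - 2/3)" for \<alpha> \<beta>
      by (simp add: RLC_poly_def A_def B_def field_simps power2_eq_square)
    show "((\<lambda>\<alpha>. A \<alpha> (\<Psi> \<alpha>)) \<longlongrightarrow> A (2/3) (2/3)) (at_left (2/3))"
      "((\<lambda>\<alpha>. B \<alpha> (\<Psi> \<alpha>)) \<longlongrightarrow> B (2/3) (2/3)) (at_left (2/3))"
      unfolding A_def B_def by (intro tendsto_intros lim)+
  qed (simp add: A_def)
  then show ?thesis
    by (simp add: A_def B_def)
qed

section \<open>The word RLLRC\<close>

definition RLLRC_poly :: "real \<Rightarrow> real \<Rightarrow> real" where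
  "RLLRC_poly \<alpha> \<beta> = (\<beta>^3 + \<beta>^2 * \<alpha> + \<beta> * \<alpha>^2 + \<alpha>^3)
     - (\<beta>^4 + \<beta>^3 * \<alpha> + \<beta>^2 * \<alpha>^2 + \<beta> * \<alpha>^3 + \<alpha>^4) - \<alpha>^2 * (1 - \<alpha>)"

lemma RLLRC_poly_factor:
  "(\<beta> - \<alpha>) * RLLRC_poly \<alpha> \<beta> = \<beta>^4 * (1 - \<beta>) - \<alpha>^2 * (1 - \<alpha>) * (\<beta> - \<alpha> * (1 - \<alpha>))"
  by (simp add: RLLRC_poly_def algebra_simps eval_nat_numeral)

lemma U_quadratic_bound:
  assumes "(\<alpha>, \<beta>) \<in> U"
  shows "\<beta> * (1 - \<beta>) < \<alpha> * (1 - \<alpha>)"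
proof -
  have "0 < (\<beta> - \<alpha>) * (\<alpha> + \<beta> - 1)"
    using U_bounds[OF assms] by (intro mult_pos_pos) auto
  then show ?thesis
    by (simp add: algebra_simps)
qed

text \<open>
  Solving the equation backwards from \<open>C\<close> gives the later orbit points in closed form; in this form
  the inequality for the third letter is \<open>\<beta> (1 - \<beta>) < \<alpha> (1 - \<alpha>)\<close>, which holds throughout \<open>U\<close>.
\<close>
lemma kneading_RLLRC_iff:
  assumes U: "(\<alpha>, \<beta>) \<in> U"
  shows "kneading \<alpha> \<beta> = Finite_itin [R, L, L, R, C] \<longleftrightarrow> RLLRC_poly \<alpha> \<beta> = 0"
proof -
  note b = U_bounds[OF U]
  define x where "x = \<beta> / (1 - \<alpha>) * (1 - \<beta>)"
  define y where "y = \<beta> / \<alpha> * x"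
  define z where "z = \<beta> / \<alpha> * y"
  have "kneading \<alpha> \<beta> = Finite_itin [R, L, L, R, C] \<longleftrightarrow>
      x < \<alpha> \<and> y < \<alpha> \<and> \<alpha> < z \<and> \<beta> / (1 - \<alpha>) * (1 - z) = \<alpha>"
    using b by (simp add: kneading_def itinerary_eq_R_iff itinerary_eq_L_iff itinerary_eq_C_iff
        x_def y_def z_def)
  also have "\<dots> \<longleftrightarrow> \<beta> / (1 - \<alpha>) * (1 - z) = \<alpha>"
  proof -
    have "x < \<alpha> \<and> y < \<alpha> \<and> \<alpha> < z" if "\<beta> / (1 - \<alpha>) * (1 - z) = \<alpha>"
    proof (intro conjI)
      have z: "\<beta> * z = \<beta> - \<alpha> * (1 - \<alpha>)"
        using that b by (simp add: field_simps)
      have "\<beta> * \<alpha> < \<beta> * z"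
      proof -
        have "0 < (\<beta> - \<alpha>) * (1 - \<alpha>)"
          using b by simp
        then show ?thesis
          by (simp add: z algebra_simps)
      qed
      then show "\<alpha> < z"
        using b by simp
      have y: "\<beta> * y = \<alpha> * z" and x: "\<beta> * x = \<alpha> * y"
        using b by (simp_all add: z_def y_def)
      have "z < \<beta>"
      proof -
        have "\<beta> * z < \<beta> * \<beta>"
          using U_quadratic_bound[OF U] by (simp add: z algebra_simps)
        then show ?thesis
          using b by simp
      qed
      then have "\<beta> * y < \<beta> * \<alpha>"
        using b by (simp add: y)
      then show "y < \<alpha>"
        using b by simp
      then have "\<beta> * x < \<alpha> * \<alpha>"
        using b by (simp add: x)
      also have "\<dots> < \<beta> * \<alpha>"
        using b by simp
      finally show "x < \<alpha>"
        using b by simp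
    qed
    then show ?thesis by blast
  qed
  also have "\<dots> \<longleftrightarrow> \<beta> - \<beta> * z = \<alpha> * (1 - \<alpha>)"
    using b by (simp add: field_simps)
  also have "\<beta> * z = \<beta>^4 * (1 - \<beta>) / (\<alpha>^2 * (1 - \<alpha>))"
    using b by (simp add: x_def y_def z_def field_simps eval_nat_numeral)
  also have "\<beta> - \<beta>^4 * (1 - \<beta>) / (\<alpha>^2 * (1 - \<alpha>)) = \<alpha> * (1 - \<alpha>) \<longleftrightarrow>
      \<beta>^4 * (1 - \<beta>) / (\<alpha>^2 * (1 - \<alpha>)) = \<beta> - \<alpha> * (1 - \<alpha>)"
    by auto
  also have "\<dots> \<longleftrightarrow> \<beta>^4 * (1 - \<beta>) = \<alpha>^2 * (1 - \<alpha>) * (\<beta> - \<alpha> * (1 - \<alpha>))"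
    using b by (subst divide_eq_eq) (auto simp: mult_ac)
  also have "\<dots> \<longleftrightarrow> (\<beta> - \<alpha>) * RLLRC_poly \<alpha> \<beta> = 0"
    by (simp add: RLLRC_poly_factor)
  also have "\<dots> \<longleftrightarrow> RLLRC_poly \<alpha> \<beta> = 0"
    using b by simp
  finally show ?thesis .
qed

text \<open>With \<open>q = \<alpha> (1 - \<alpha>)\<close>, the equation \<open>RLLRC_poly \<alpha> \<beta> = 0\<close> fixes the value of this ratio.\<close>
definition level_ratio :: "real \<Rightarrow> real \<Rightarrow> real" where
  "level_ratio q x = x^4 * (1 - x) / (x - q)"

text \<open>The quadratic factor of the derivative of \<open>level_ratio q\<close>, which carries its sign.\<close>
definition ratio_slope :: "real \<Rightarrow> real \<Rightarrow> real" where
  "ratio_slope q x = - 4 * x^2 + (3 + 5 * q) * x - 4 * q"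

lemma has_derivative_level_ratio:
  assumes "q < x"
  shows "(level_ratio q has_real_derivative x^3 * ratio_slope q x / (x - q)^2) (at x)"
  unfolding level_ratio_def[abs_def] ratio_slope_def
  using assms
  by (auto intro!: derivative_eq_intros simp: field_simps eval_nat_numeral)

text \<open>
  A concave quadratic that is positive at \<open>1/2\<close> stays negative once it has dropped to zero; the
  identity below is the three-point form of concavity.
\<close>
lemma ratio_slope_neg_after:
  assumes q: "q \<le> 1/4" and "1/2 \<le> x" "x < y" "ratio_slope q x \<le> 0"
  shows "ratio_slope q y < 0"
proof (rule ccontr)
  assume y: "\<not> ratio_slope q y < 0"
  have "ratio_slope q x * (y - 1/2) = ratio_slope q (1/2) * (y - x) + ratio_slope q y * (x - 1/2)
      + 4 * ((x - 1/2) * (y - x) * (y - 1/2))"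
    by (simp add: ratio_slope_def field_simps power2_eq_square)
  moreover have "0 < ratio_slope q (1/2)"
    using q by (simp add: ratio_slope_def power2_eq_square field_simps)
  moreover from this have "0 < ratio_slope q (1/2) * (y - x)"
    using assms by simp
  moreover have "0 \<le> ratio_slope q y * (x - 1/2)" "0 \<le> (x - 1/2) * (y - x) * (y - 1/2)"
    using y assms by auto
  moreover have "ratio_slope q x * (y - 1/2) \<le> 0"
    using assms by (simp add: mult_nonpos_nonneg)
  ultimately show False
    by linarith
qed

lemma level_ratio_mvt:
  assumes "q < x" "x < y"
  obtains \<xi> where "x < \<xi>" "\<xi> < y"
    "level_ratio q y - level_ratio q x = (y - x) * (\<xi>^3 * ratio_slope q \<xi> / (\<xi> - q)^2)"
  using MVT2[of x y "level_ratio q" "\<lambda>\<xi>. \<xi>^3 * ratio_slope q \<xi> / (\<xi> - q)^2"]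
    has_derivative_level_ratio assms by fastforce

lemma level_ratio_less:
  assumes "q \<le> 1/4" "1/2 \<le> x" "x < y" "ratio_slope q x \<le> 0"
  shows "level_ratio q y < level_ratio q x"
proof -
  obtain \<xi> where \<xi>: "x < \<xi>" "\<xi> < y"
    "level_ratio q y - level_ratio q x = (y - x) * (\<xi>^3 * ratio_slope q \<xi> / (\<xi> - q)^2)"
    using level_ratio_mvt[of q x y] assms by auto
  have "ratio_slope q \<xi> < 0"
    using ratio_slope_neg_after[of q x \<xi>] assms \<xi> by simp
  then have "(y - x) * (\<xi>^3 * ratio_slope q \<xi> / (\<xi> - q)^2) < 0"
    using assms \<xi> by (intro mult_pos_neg divide_neg_pos) auto
  with \<xi> show ?thesis
    by simp
qed

lemma level_ratio_unimodal:
  assumes "q \<le> 1/4" "1/2 \<le> x" "x < y" "y < z" "level_ratio q y \<le> level_ratio q x"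
  shows "level_ratio q z < level_ratio q y"
proof -
  obtain \<xi> where \<xi>: "x < \<xi>" "\<xi> < y"
    "level_ratio q y - level_ratio q x = (y - x) * (\<xi>^3 * ratio_slope q \<xi> / (\<xi> - q)^2)"
    using level_ratio_mvt[of q x y] assms by auto
  have "\<not> 0 < ratio_slope q \<xi>"
  proof
    assume "0 < ratio_slope q \<xi>"
    then have "0 < (y - x) * (\<xi>^3 * ratio_slope q \<xi> / (\<xi> - q)^2)"
      using assms \<xi> by (intro mult_pos_pos divide_pos_pos) auto
    with \<xi> assms show False
      by simp
  qed
  then have "ratio_slope q y < 0"
    using ratio_slope_neg_after[of q \<xi> y] assms \<xi> by simp
  then show ?thesis
    using level_ratio_less[of q y z] assms by simp
qed

lemma quarter_bound: "\<alpha> * (1 - \<alpha>) \<le> (1/4 :: real)"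
proof -
  have "0 \<le> (\<alpha> - 1/2)^2"
    by simp
  then show ?thesis
    by (simp add: power2_eq_square algebra_simps)
qed

lemma RLLRC_poly_eq_0_iff:
  assumes "(\<alpha>, \<beta>) \<in> U"
  shows "RLLRC_poly \<alpha> \<beta> = 0 \<longleftrightarrow> level_ratio (\<alpha> * (1 - \<alpha>)) \<beta> = \<alpha>^2 * (1 - \<alpha>)"
proof -
  have "RLLRC_poly \<alpha> \<beta> = 0 \<longleftrightarrow> (\<beta> - \<alpha>) * RLLRC_poly \<alpha> \<beta> = 0"
    using U_bounds[OF assms] by simp
  also have "\<dots> \<longleftrightarrow> \<beta>^4 * (1 - \<beta>) = \<alpha>^2 * (1 - \<alpha>) * (\<beta> - \<alpha> * (1 - \<alpha>))"
    by (simp add: RLLRC_poly_factor)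
  also have "\<dots> \<longleftrightarrow> level_ratio (\<alpha> * (1 - \<alpha>)) \<beta> = \<alpha>^2 * (1 - \<alpha>)"
    using U_bounds[OF assms] quarter_bound[of \<alpha>]
    unfolding level_ratio_def by (subst divide_eq_eq) auto
  finally show ?thesis .
qed

lemma level_ratio_diagonal:
  assumes "0 < \<alpha>"
  shows "level_ratio (\<alpha> * (1 - \<alpha>)) \<alpha> = \<alpha>^2 * (1 - \<alpha>)"
proof -
  have "\<alpha> - \<alpha> * (1 - \<alpha>) = \<alpha>^2"
    by (simp add: power2_eq_square algebra_simps)
  then show ?thesis
    using assms by (simp add: level_ratio_def eval_nat_numeral)
qed

lemma level_ratio_antidiagonal:
  assumes "\<alpha> < 1"
  shows "level_ratio (\<alpha> * (1 - \<alpha>)) (1 - \<alpha>) = (1 - \<alpha>)^2 * \<alpha>"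
proof -
  have "1 - \<alpha> - \<alpha> * (1 - \<alpha>) = (1 - \<alpha>)^2"
    by (simp add: power2_eq_square algebra_simps)
  then show ?thesis
    using assms by (simp add: level_ratio_def eval_nat_numeral)
qed

lemma level_ratio_lower_end:
  assumes "0 < \<alpha>" "\<alpha> < 1"
  shows "\<alpha>^2 * (1 - \<alpha>) \<le> level_ratio (\<alpha> * (1 - \<alpha>)) (max \<alpha> (1 - \<alpha>))"
proof (cases "1 - \<alpha> \<le> \<alpha>")
  case True
  then show ?thesis
    using level_ratio_diagonal assms by (simp add: max_absorb1)
next
  case False
  then have "\<alpha> * (1 - \<alpha>) * \<alpha> \<le> \<alpha> * (1 - \<alpha>) * (1 - \<alpha>)"
    using assms by (intro mult_left_mono) auto
  then show ?thesis
    using False assms by (simp add: max_def level_ratio_antidiagonal power2_eq_square mult_ac)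
qed

abbreviation (input) "RLLRC_end \<equiv> sqrt 5 / 10 + 1 / 2"

lemma RLLRC_end_square: "RLLRC_end\<^sup>2 = RLLRC_end - 1/5"
  by (simp add: power2_eq_square field_simps)

lemma RLLRC_end_bounds: "1/2 < RLLRC_end" "RLLRC_end < 1"
proof -
  have "sqrt 5 < 5"
    by (rule real_less_lsqrt) auto
  then show "RLLRC_end < 1"
    by simp
qed simp

lemma RLLRC_diagonal_factor:
  "5 * \<alpha> - 1 - 5 * \<alpha>\<^sup>2 = 5 * ((RLLRC_end - \<alpha>) * (\<alpha> - (1 - RLLRC_end)))"
  by (simp add: power2_eq_square field_simps)

interpretation RLLRC: kneading_equation "Finite_itin [R, L, L, R, C]" RLLRC_poly RLLRC_end
proof
  fix \<alpha> \<beta> \<gamma> :: real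
  show "(\<alpha>, \<beta>) \<in> U \<Longrightarrow> kneading \<alpha> \<beta> = Finite_itin [R, L, L, R, C] \<longleftrightarrow> RLLRC_poly \<alpha> \<beta> = 0"
    by (rule kneading_RLLRC_iff)
  have "RLLRC_poly \<alpha> (1 - \<alpha>) = \<alpha> * (1 - \<alpha>)^3"
    by (simp add: RLLRC_poly_def algebra_simps eval_nat_numeral)
  then show "0 < \<alpha> \<Longrightarrow> \<alpha> < 1 \<Longrightarrow> 0 < RLLRC_poly \<alpha> (1 - \<alpha>)"
    by simp
  have diagonal: "RLLRC_poly \<alpha> \<alpha> = \<alpha>^2 * (5 * \<alpha> - 1 - 5 * \<alpha>^2)"
    by (simp add: RLLRC_poly_def algebra_simps eval_nat_numeral)
  then show "1/2 \<le> \<alpha> \<Longrightarrow> \<alpha> < RLLRC_end \<Longrightarrow> 0 < RLLRC_poly \<alpha> \<alpha>"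
    unfolding RLLRC_diagonal_factor
    using RLLRC_end_bounds by (auto intro!: mult_pos_pos)
  have "RLLRC_poly \<alpha> 1 = - (\<alpha>^2 * ((1 - \<alpha>) + \<alpha>^2))"
    by (simp add: RLLRC_poly_def algebra_simps eval_nat_numeral)
  then show "RLLRC_poly \<alpha> 1 < 0" if "0 < \<alpha>" "\<alpha> < 1"
    using that by (simp add: add_pos_nonneg)
  have no_two_roots: False
    if U: "(\<alpha>, \<beta>) \<in> U" "(\<alpha>, \<gamma>) \<in> U" and "RLLRC_poly \<alpha> \<beta> = 0" "RLLRC_poly \<alpha> \<gamma> = 0" "\<beta> < \<gamma>"
    for \<beta> \<gamma>
  proof -
    let ?q = "\<alpha> * (1 - \<alpha>)"
    have "level_ratio ?q \<gamma> < level_ratio ?q \<beta>"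
    proof (rule level_ratio_unimodal)
      show "level_ratio ?q \<beta> \<le> level_ratio ?q (max \<alpha> (1 - \<alpha>))"
        using level_ratio_lower_end[of \<alpha>] that by (simp add: RLLRC_poly_eq_0_iff U_bounds)
      show "max \<alpha> (1 - \<alpha>) < \<beta>"
        using U by (simp add: U_iff)
      show "1/2 \<le> max \<alpha> (1 - \<alpha>)"
        by (simp add: max_def)
    qed (use quarter_bound \<open>\<beta> < \<gamma>\<close> in auto)
    then show False
      using that by (simp add: RLLRC_poly_eq_0_iff)
  qed
  then show "(\<alpha>, \<beta>) \<in> U \<Longrightarrow> (\<alpha>, \<gamma>) \<in> U \<Longrightarrow> RLLRC_poly \<alpha> \<beta> = 0 \<Longrightarrow> RLLRC_poly \<alpha> \<gamma> = 0 \<Longrightarrow> \<beta> = \<gamma>"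
    by (meson linorder_neqE_linordered_idom)
  show "RLLRC_poly \<alpha> \<beta> \<noteq> 0" if U: "(\<alpha>, \<beta>) \<in> U" and "RLLRC_end \<le> \<alpha>"
  proof -
    let ?q = "\<alpha> * (1 - \<alpha>)"
    note b = U_bounds[OF U]
    have "(RLLRC_end - \<alpha>) * (\<alpha> - (1 - RLLRC_end)) \<le> 0"
      using \<open>RLLRC_end \<le> \<alpha>\<close> RLLRC_end_bounds by (intro mult_nonpos_nonneg) linarith+
    then have "5 * \<alpha> - 1 - 5 * \<alpha>^2 \<le> 0"
      unfolding RLLRC_diagonal_factor by linarith
    have "ratio_slope ?q \<alpha> = \<alpha> * (5 * \<alpha> - 1 - 5 * \<alpha>^2)"
      by (simp add: ratio_slope_def algebra_simps power2_eq_square)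
    also have "\<dots> \<le> 0"
      using b \<open>5 * \<alpha> - 1 - 5 * \<alpha>^2 \<le> 0\<close> by (intro mult_nonneg_nonpos) auto
    finally have "level_ratio ?q \<beta> < level_ratio ?q \<alpha>"
      using level_ratio_less[of ?q \<alpha> \<beta>] quarter_bound \<open>RLLRC_end \<le> \<alpha>\<close> RLLRC_end_bounds b by auto
    then show ?thesis
      using b by (simp add: RLLRC_poly_eq_0_iff[OF U] level_ratio_diagonal)
  qed
  show "continuous_on UNIV (\<lambda>\<alpha>. RLLRC_poly \<alpha> \<beta>)" "continuous_on UNIV (RLLRC_poly \<alpha>)"
    unfolding RLLRC_poly_def by (intro continuous_intros)+
qed (use RLLRC_end_bounds in auto)

text \<open>
  The increment is split along the path from \<open>(b, b)\<close> through \<open>(\<alpha>, b)\<close> to \<open>(\<alpha>, \<beta>)\<close>. Each leg changes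
  a single variable, so the increment over it is divisible by the change of that variable.
\<close>
lemma RLLRC_poly_divided_differences:
  fixes b :: real
  shows "RLLRC_poly \<alpha> \<beta> - RLLRC_poly b b =
    ((\<beta>^2 + \<beta> * b + b^2) + \<alpha> * (\<beta> + b) + \<alpha>^2 - (\<beta>^3 + \<beta>^2 * b + \<beta> * b^2 + b^3)
      - \<alpha> * (\<beta>^2 + \<beta> * b + b^2) - \<alpha>^2 * (\<beta> + b) - \<alpha>^3) * (\<beta> - b) +
    (b^2 + b * (\<alpha> + b) + 2 * (\<alpha>^2 + \<alpha> * b + b^2) - b^3 - b^2 * (\<alpha> + b)
      - b * (\<alpha>^2 + \<alpha> * b + b^2) - (\<alpha>^3 + \<alpha>^2 * b + \<alpha> * b^2 + b^3) - (\<alpha> + b)) * (\<alpha> - b)"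
  by (simp add: RLLRC_poly_def algebra_simps eval_nat_numeral)

lemma RLLRC_slope:
  assumes curve: "equi_kneading_curve (Finite_itin [R, L, L, R, C]) \<alpha>1 \<alpha>2 \<Psi>"
  shows "has_endpoint_slope \<Psi> RLLRC_end (- ((sqrt 5 + 3) / (2 * sqrt 5 + 2)))"
proof -
  define b where "b = RLLRC_end"
  define A B :: "real \<Rightarrow> real \<Rightarrow> real"
    where "A = (\<lambda>\<alpha> \<beta>. (\<beta>^2 + \<beta> * b + b^2) + \<alpha> * (\<beta> + b) + \<alpha>^2 - (\<beta>^3 + \<beta>^2 * b + \<beta> * b^2 + b^3)
        - \<alpha> * (\<beta>^2 + \<beta> * b + b^2) - \<alpha>^2 * (\<beta> + b) - \<alpha>^3)"
      and "B = (\<lambda>\<alpha> \<beta>. b^2 + b * (\<alpha> + b) + 2 * (\<alpha>^2 + \<alpha> * b + b^2) - b^3 - b^2 * (\<alpha> + b)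
        - b * (\<alpha>^2 + \<alpha> * b + b^2) - (\<alpha>^3 + \<alpha>^2 * b + \<alpha> * b^2 + b^3) - (\<alpha> + b))"
  have sq: "b^2 = b - 1/5"
    using RLLRC_end_square by (simp add: b_def)
  have "A b b = b * (6 * b - 10 * b^2)"
    by (simp add: A_def algebra_simps eval_nat_numeral)
  also have "\<dots> = b * (2 - 4 * b)"
    by (simp add: sq)
  finally have A_end: "A b b = b * (2 - 4 * b)" .
  have "B b b = b * (9 * b - 10 * b^2 - 2)"
    by (simp add: B_def algebra_simps eval_nat_numeral)
  also have "\<dots> = b * (- b)"
    by (simp add: sq)
  finally have B_end: "B b b = b * (- b)" .
  have b: "1/2 < b"
    using RLLRC_end_bounds by (simp add: b_def)
  note lim = RLLRC.curve_tendsto[OF curve, folded b_def]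
  have "has_endpoint_slope \<Psi> b (- (B b b / A b b))"
  proof (rule RLLRC.curve_slope[OF curve, folded b_def, where A = A and B = B])
    have "RLLRC_poly b b = b^2 * (5 * b - 1 - 5 * b^2)"
      by (simp add: RLLRC_poly_def algebra_simps eval_nat_numeral)
    then have "RLLRC_poly b b = 0"
      by (simp add: sq)
    then show "RLLRC_poly \<alpha> \<beta> = A \<alpha> \<beta> * (\<beta> - b) + B \<alpha> \<beta> * (\<alpha> - b)" for \<alpha> \<beta>
      using RLLRC_poly_divided_differences[of \<alpha> \<beta> b] by (simp add: A_def B_def)
    show "((\<lambda>\<alpha>. A \<alpha> (\<Psi> \<alpha>)) \<longlongrightarrow> A b b) (at_left b)" "((\<lambda>\<alpha>. B \<alpha> (\<Psi> \<alpha>)) \<longlongrightarrow> B b b) (at_left b)"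
      unfolding A_def B_def by (intro tendsto_intros lim)+
    show "A b b \<noteq> 0"
      using b by (simp add: A_end)
  qed
  also have "- (B b b / A b b) = b / (2 - 4 * b)"
    using b by (simp add: A_end B_end)
  also have "\<dots> = - ((sqrt 5 + 3) / (2 * sqrt 5 + 2))"
  proof -
    have "0 < 2 * sqrt 5 + (2 :: real)"
      by (intro add_pos_pos) auto
    then show ?thesis
      by (simp add: b_def field_simps)
  qed
  finally show ?thesis
    by (simp add: b_def)
qed

section \<open>The two slopes\<close>

theorem mainTheorem5:
  "((\<exists>\<alpha>1 \<alpha>2 \<Psi>. equi_kneading_curve (Finite_itin [R, L, C]) \<alpha>1 \<alpha>2 \<Psi>) \<and>
    (\<forall>\<alpha>1 \<alpha>2 \<Psi>. equi_kneading_curve (Finite_itin [R, L, C]) \<alpha>1 \<alpha>2 \<Psi> \<longrightarrow>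
       (let \<beta>0 = 2 / 3 in
          meets_diagonal_at \<Psi> \<alpha>2 \<beta>0 \<and>
          has_endpoint_slope \<Psi> \<beta>0 (-1) \<and>
          orthogonal_to_diagonal_at \<Psi> \<beta>0))) \<and>
   ((\<exists>\<alpha>1 \<alpha>2 \<Psi>. equi_kneading_curve (Finite_itin [R, L, L, R, C]) \<alpha>1 \<alpha>2 \<Psi>) \<and>
    (\<forall>\<alpha>1 \<alpha>2 \<Psi>. equi_kneading_curve (Finite_itin [R, L, L, R, C]) \<alpha>1 \<alpha>2 \<Psi> \<longrightarrow>
       (let \<beta>0 = sqrt 5 / 10 + 1 / 2; D = - ((sqrt 5 + 3) / (2 * sqrt 5 + 2)) in
          meets_diagonal_at \<Psi> \<alpha>2 \<beta>0 \<and>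
          has_endpoint_slope \<Psi> \<beta>0 D \<and> D \<noteq> -1 \<and>
          \<not> orthogonal_to_diagonal_at \<Psi> \<beta>0)))"
proof -
  have RLC: "meets_diagonal_at \<Psi> \<alpha>2 (2 / 3) \<and> has_endpoint_slope \<Psi> (2 / 3) (-1) \<and>
      orthogonal_to_diagonal_at \<Psi> (2 / 3)"
    if "equi_kneading_curve (Finite_itin [R, L, C]) \<alpha>1 \<alpha>2 \<Psi>" for \<alpha>1 \<alpha>2 \<Psi>
    using RLC.curve_meets_diagonal[OF that] RLC_slope[OF that]
      orthogonal_to_diagonal_iff[OF RLC_slope[OF that]] by simp
  have slope_ne: "- ((sqrt 5 + 3) / (2 * sqrt 5 + 2)) \<noteq> (-1 :: real)"
  proof
    assume "- ((sqrt 5 + 3) / (2 * sqrt 5 + 2)) = (-1 :: real)"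
    moreover have "0 < 2 * sqrt 5 + (2 :: real)"
      by (intro add_pos_pos) auto
    ultimately have "sqrt 5 = (1 :: real)"
      by (simp add: field_simps)
    then show False
      by simp
  qed
  have RLLRC: "meets_diagonal_at \<Psi> \<alpha>2 RLLRC_end \<and>
      has_endpoint_slope \<Psi> RLLRC_end (- ((sqrt 5 + 3) / (2 * sqrt 5 + 2))) \<and>
      \<not> orthogonal_to_diagonal_at \<Psi> RLLRC_end"
    if "equi_kneading_curve (Finite_itin [R, L, L, R, C]) \<alpha>1 \<alpha>2 \<Psi>" for \<alpha>1 \<alpha>2 \<Psi>
    using RLLRC.curve_meets_diagonal[OF that] RLLRC_slope[OF that]
      orthogonal_to_diagonal_iff[OF RLLRC_slope[OF that]] slope_ne by blast
  show ?thesis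
    unfolding Let_def
    by (intro conjI allI impI RLC.ex_curve RLLRC.ex_curve) (simp_all only: RLC RLLRC slope_ne not_False_eq_True)
qed

end
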